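(* If $n\geq 3$ and $C_n$ is the cycle on $n$ vertices, then $B(C_n) = 2$ if $n\leq 5$ and $B(C_n) = 3$ if $n>5$.
   Context: Bodyguards and Presidents is a two-player game on a finite simple graph $G$. One player controls a set of tokens called bodyguards, the other a single token called the president. First all bodyguards are placed on vertices (several may share a vertex), then the president is placed. The players then alternate turns, bodyguards first; on a player's turn, each token they control either moves to an adjacent vertex or stays put. The president is surrounded if every vertex of the open neighbourhood of the president's vertex is occupied by a bodyguard. The bodyguards win if there is a finite time after which, at the end of every bodyguard turn, the president is surrounded; otherwise the president wins. The bodyguard number $B(G)$ is the minimum number of bodyguards that guarantees a win for the bodyguards on $G$. *)

theory Defs
  imports "Graph_Theory.Pair_Digraph"
begin

text \<open>
  Finite simple graphs are represented as in \<^locale>\<open>pair_graph\<close>: every undirected edge is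
  the pair of opposite arcs.
\<close>

definition cycle_graph :: "nat \<Rightarrow> nat pair_pre_digraph" where
  "cycle_graph n =
     \<lparr> pverts = {0..<n},
       parcs = {(u, v). u < n \<and> v < n \<and> (v = (u + 1) mod n \<or> u = (v + 1) mod n)} \<rparr>"

lemma pair_graph_cycle_graph:
  assumes "n \<ge> 3"
  shows "pair_graph (cycle_graph n)"
proof
  show "finite (parcs (cycle_graph n))"
    by (rule finite_subset[of _ "{0..<n} \<times> {0..<n}"]) (auto simp: cycle_graph_def)
  show "symmetric (cycle_graph n)"
    by (auto simp: cycle_graph_def symmetric_def sym_def)
  fix e assume "e \<in> parcs (cycle_graph n)"
  then show "fst e \<noteq> snd e"
    using assms by (auto simp: cycle_graph_def mod_Suc split: if_splits)
qed (auto simp: cycle_graph_def)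

definition open_nbhd :: "'a pair_pre_digraph \<Rightarrow> 'a \<Rightarrow> 'a set" where
  "open_nbhd G v = {w. (v, w) \<in> parcs G}"

definition token_move :: "'a pair_pre_digraph \<Rightarrow> 'a \<Rightarrow> 'a \<Rightarrow> bool" where
  "token_move G u v \<longleftrightarrow> v = u \<or> v \<in> open_nbhd G u"

text \<open>
  A placement of \<open>k\<close> bodyguards is a list of \<open>k\<close> vertices, entry \<open>i\<close> being the position of the
  \<open>i\<close>-th bodyguard; repetitions are allowed.
\<close>

definition placement :: "'a pair_pre_digraph \<Rightarrow> nat \<Rightarrow> 'a list \<Rightarrow> bool" where
  "placement G k bs \<longleftrightarrow> length bs = k \<and> set bs \<subseteq> pverts G"

definition bodyguards_move :: "'a pair_pre_digraph \<Rightarrow> 'a list \<Rightarrow> 'a list \<Rightarrow> bool" where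
  "bodyguards_move G = list_all2 (token_move G)"

definition surrounded :: "'a pair_pre_digraph \<Rightarrow> 'a list \<Rightarrow> 'a \<Rightarrow> bool" where
  "surrounded G bs p \<longleftrightarrow> open_nbhd G p \<subseteq> set bs"

text \<open>
  A play is given by \<open>b 0, p 0, b 1, p 1, b 2, \<dots>\<close> in this temporal order: \<open>b 0\<close> and \<open>p 0\<close> are the
  initial placements, and \<open>b t\<close> and \<open>p t\<close> are the positions after the \<open>t\<close>-th turn of the
  respective player.  Hence at the end of the bodyguard turn \<open>Suc t\<close> the bodyguards are at
  \<open>b (Suc t)\<close> and the president is still at \<open>p t\<close>.
\<close>

definition president_legal :: "'a pair_pre_digraph \<Rightarrow> (nat \<Rightarrow> 'a) \<Rightarrow> bool" where
  "president_legal G p \<longleftrightarrow> p 0 \<in> pverts G \<and> (\<forall>t. token_move G (p t) (p (Suc t)))"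

definition bodyguards_legal ::
    "'a pair_pre_digraph \<Rightarrow> nat \<Rightarrow> (nat \<Rightarrow> 'a list) \<Rightarrow> bool" where
  "bodyguards_legal G k b \<longleftrightarrow>
     placement G k (b 0) \<and> (\<forall>t. bodyguards_move G (b t) (b (Suc t)))"

definition bodyguards_win_play ::
    "'a pair_pre_digraph \<Rightarrow> (nat \<Rightarrow> 'a list) \<Rightarrow> (nat \<Rightarrow> 'a) \<Rightarrow> bool" where
  "bodyguards_win_play G b p \<longleftrightarrow> (\<exists>T. \<forall>t\<ge>T. surrounded G (b (Suc t)) (p t))"

text \<open>
  A bodyguard strategy maps the complete history \<open>[(b 0, p 0), \<dots>, (b t, p t)]\<close> to the next
  bodyguard placement \<open>b (Suc t)\<close>; on the empty history it yields the initial placement.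
\<close>

definition follows ::
    "(('a list \<times> 'a) list \<Rightarrow> 'a list) \<Rightarrow> (nat \<Rightarrow> 'a list) \<Rightarrow> (nat \<Rightarrow> 'a) \<Rightarrow> bool" where
  "follows \<sigma> b p \<longleftrightarrow> (\<forall>t. b t = \<sigma> (map (\<lambda>i. (b i, p i)) [0..<t]))"

definition bodyguards_can_win :: "'a pair_pre_digraph \<Rightarrow> nat \<Rightarrow> bool" where
  "bodyguards_can_win G k \<longleftrightarrow>
     (\<exists>\<sigma>. \<forall>b p. president_legal G p \<and> follows \<sigma> b p \<longrightarrow>
        bodyguards_legal G k b \<and> bodyguards_win_play G b p)"

definition bodyguard_number :: "'a pair_pre_digraph \<Rightarrow> nat" where
  "bodyguard_number G = (LEAST k. bodyguards_can_win G k)"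

text \<open>The minimum is attained: one immobile bodyguard on each vertex always suffices.\<close>

lemma bodyguards_can_win_card:
  assumes "pair_graph G"
  shows "bodyguards_can_win G (card (pverts G))"
proof -
  interpret pair_graph G by fact
  obtain bs where bs: "set bs = pverts G" "distinct bs"
    using finite_distinct_list[OF pair_finite_verts] by blast
  have "bodyguards_legal G (card (pverts G)) b \<and> bodyguards_win_play G b p"
    if "follows (\<lambda>_. bs) b p" for b p
  proof -
    have "b t = bs" for t
      using that by (simp add: follows_def)
    moreover have "open_nbhd G v \<subseteq> pverts G" for v
      by (auto simp: open_nbhd_def dest: in_arcsD2)
    ultimately show ?thesis
      using bs distinct_card[of bs]
      by (simp add: bodyguards_legal_def placement_def bodyguards_move_def token_move_def
          bodyguards_win_play_def surrounded_def list.rel_refl)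
  qed
  then show ?thesis
    unfolding bodyguards_can_win_def by blast
qed

end

theory Submission
  imports Defs "HOL-Library.Multiset"
begin

text \<open>The two neighbours of a vertex are distinct, so fewer than two bodyguards never surround
  anyone. Two bodyguards on the two neighbours of the president can mirror every move of hers; the
  question is whether this flanking position can be forced.

  For n <= 5, two bodyguards at distance 2 can flank any vertex within one turn
  (\<open>two_bodyguards_can_win\<close>). For n > 5, a president who is not surrounded can always
  move to a vertex where the next bodyguard turn cannot surround her
  (\<open>president_escapes_two_bodyguards\<close>), and she repeats this forever. A third bodyguard
  breaks the evasion: while one of them shadows the president, the other two approach from both
  sides, and their total distance drops by 2 per turn whatever she does
  (\<open>three_bodyguards_can_win\<close>).

  Positional arguments become statements about history-dependent strategies through a ranking
  criterion for the bodyguards and a safety criterion for the president.\<close>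

section \<open>Winning criteria for the two players\<close>

text \<open>The rank \<open>r\<close> never grows and falls on each turn that does not end with the
  president surrounded, so there are only finitely many such turns. Comparing placements by
  \<open>mset\<close> lets \<open>I\<close> list the bodyguards by role, although roles are
  exchanged during the play.\<close>

lemma bodyguards_can_winI:
  fixes I :: "nat \<Rightarrow> 'a list \<Rightarrow> 'a \<Rightarrow> bool"
  assumes placed: "placement G k b0"
    and init: "\<And>p. p \<in> pverts G \<Longrightarrow> \<exists>r. I r b0 p"
    and step: "\<And>r bs p. I r bs p \<Longrightarrow> \<exists>bs'. bodyguards_move G bs bs' \<and>
      (\<forall>p'. token_move G p p' \<longrightarrow> (\<exists>r'\<le>r. \<exists>cs. mset cs = mset bs' \<and> I r' cs p' \<and>
        (surrounded G bs' p \<or> r' < r)))"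
  shows "bodyguards_can_win G k"
proof -
  define J where "J r bs p \<longleftrightarrow> (\<exists>cs. mset cs = mset bs \<and> I r cs p)" for r bs p
  define P where "P r bs p bs' \<longleftrightarrow> bodyguards_move G bs bs' \<and>
      (\<forall>p'. token_move G p p' \<longrightarrow> (\<exists>r'\<le>r. J r' bs' p' \<and> (surrounded G bs' p \<or> r' < r)))"
    for r bs p bs'
  have stepJ: "\<exists>bs'. P r bs p bs'" if "J r bs p" for r bs p
  proof -
    obtain cs where cs: "mset bs = mset cs" "I r cs p"
      using \<open>J r bs p\<close> unfolding J_def by metis
    obtain cs' where move: "list_all2 (token_move G) cs cs'"
      and next_state: "\<And>p'. token_move G p p' \<Longrightarrow> \<exists>r'\<le>r. \<exists>ds. mset ds = mset cs' \<and> I r' ds p' \<and>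
        (surrounded G cs' p \<or> r' < r)"
      using step[OF cs(2)] unfolding bodyguards_move_def by blast
    obtain bs' where bs': "list_all2 (token_move G) bs bs'" "mset bs' = mset cs'"
      using list_all2_reorder_left_invariance[OF move cs(1)] by blast
    have "set bs' = set cs'"
      using bs'(2) by (rule mset_eq_setD)
    then have "P r bs p bs'"
      using bs' next_state unfolding P_def bodyguards_move_def J_def surrounded_def by metis
    then show ?thesis ..
  qed
  \<comment> \<open>The least admissible rank depends on the position alone, so the strategy needs
    only the last entry of the history.\<close>
  define \<mu> where "\<mu> bs p = (LEAST r. J r bs p)" for bs p
  define f where "f bs p = (SOME bs'. P (\<mu> bs p) bs p bs')" for bs p
  define \<sigma> where "\<sigma> h = (if h = [] then b0 else f (fst (last h)) (snd (last h)))" for h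
  have "bodyguards_legal G k b \<and> bodyguards_win_play G b p"
    if legal: "president_legal G p" and follows: "follows \<sigma> b p" for b p
  proof -
    have b_0: "b 0 = b0" and b_Suc: "b (Suc t) = f (b t) (p t)" for t
      using follows by (auto simp: follows_def \<sigma>_def)
    have p_move: "token_move G (p t) (p (Suc t))" for t
      using legal by (simp add: president_legal_def)
    have choice: "P (\<mu> (b t) (p t)) (b t) (p t) (b (Suc t))" if "\<exists>r. J r (b t) (p t)" for t
      using stepJ[OF LeastI_ex[OF that]] unfolding b_Suc f_def \<mu>_def by (rule someI_ex)
    have inv: "\<exists>r. J r (b t) (p t)" for t
    proof (induction t)
      case 0
      then show ?case
        using init legal unfolding J_def b_0 president_legal_def by blast
    next
      case (Suc t)
      then show ?case
        using choice[OF Suc] p_move[of t] unfolding P_def by blast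
    qed
    have descent: "\<mu> (b (Suc t)) (p (Suc t)) \<le> \<mu> (b t) (p t) \<and>
        (surrounded G (b (Suc t)) (p t) \<or> \<mu> (b (Suc t)) (p (Suc t)) < \<mu> (b t) (p t))" for t
    proof -
      obtain r where r: "r \<le> \<mu> (b t) (p t)" "J r (b (Suc t)) (p (Suc t))"
        "surrounded G (b (Suc t)) (p t) \<or> r < \<mu> (b t) (p t)"
        using choice[OF inv] p_move[of t] unfolding P_def by blast
      have "\<mu> (b (Suc t)) (p (Suc t)) \<le> r"
        unfolding \<mu>_def using r(2) by (rule Least_le)
      then show ?thesis
        using r by auto
    qed
    \<comment> \<open>From the moment the rank is minimal along the play, no further strict descent
      is possible.\<close>
    obtain T where T: "\<And>t. \<mu> (b T) (p T) \<le> \<mu> (b t) (p t)"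
      using ex_has_least_nat[of "\<lambda>_. True" _ "\<lambda>t. \<mu> (b t) (p t)"] by blast
    have "\<mu> (b t) (p t) \<le> \<mu> (b T) (p T)" if "t \<ge> T" for t
      using that by (induction rule: dec_induct) (use descent le_trans in blast)+
    then have "surrounded G (b (Suc t)) (p t)" if "t \<ge> T" for t
      using descent[of t] T[of "Suc t"] that by (meson leD le_trans not_le)
    moreover have "bodyguards_move G (b t) (b (Suc t))" for t
      using choice[OF inv] by (simp add: P_def)
    ultimately show ?thesis
      using placed by (auto simp: bodyguards_legal_def b_0 bodyguards_win_play_def)
  qed
  then show ?thesis
    unfolding bodyguards_can_win_def by blast
qed

text \<open>\<open>S\<close> is a safety invariant, taken after the president's move: playing it
  against any strategy gives a play in which she is never surrounded.\<close>

lemma bodyguards_cannot_winI: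
  fixes S :: "'a list \<Rightarrow> 'a \<Rightarrow> bool"
  assumes nonempty: "pverts G \<noteq> {}"
    and init: "\<And>bs. placement G k bs \<Longrightarrow> \<exists>p\<in>pverts G. S bs p"
    and step: "\<And>bs p bs'. S bs p \<Longrightarrow> bodyguards_move G bs bs' \<Longrightarrow>
      \<not> surrounded G bs' p \<and> (\<exists>p'. token_move G p p' \<and> S bs' p')"
  shows "\<not> bodyguards_can_win G k"
proof
  assume "bodyguards_can_win G k"
  then obtain \<sigma> where \<sigma>: "\<And>b p. president_legal G p \<Longrightarrow> follows \<sigma> b p \<Longrightarrow>
      bodyguards_legal G k b \<and> bodyguards_win_play G b p"
    unfolding bodyguards_can_win_def by blast
  \<comment> \<open>The president's choices are made legal unconditionally, so that the legality of the
    bodyguards' moves can be drawn from \<open>\<sigma>\<close> before the safety of the play is known.\<close>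
  define first where "first bs = (SOME p. p \<in> pverts G \<and> (placement G k bs \<longrightarrow> S bs p))" for bs
  define reply where "reply p bs = (SOME p'. token_move G p p' \<and>
      ((\<exists>q. token_move G p q \<and> S bs q) \<longrightarrow> S bs p'))" for p bs
  define \<tau> where "\<tau> h = (if h = [] then first (\<sigma> h) else reply (snd (last h)) (\<sigma> h))" for h
  \<comment> \<open>Each player's choice depends on the other's earlier ones, so the common history
    is built by recursion and both sequences are read off from it.\<close>
  define H where "H t = rec_nat [] (\<lambda>_ h. h @ [(\<sigma> h, \<tau> h)]) t" for t :: nat
  have H_0: "H 0 = []" and H_Suc: "H (Suc t) = H t @ [(\<sigma> (H t), \<tau> (H t))]" for t
    by (simp_all add: H_def)
  define b where "b t = \<sigma> (H t)" for t
  define p where "p t = \<tau> (H t)" for t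
  have H_eq: "H t = map (\<lambda>i. (b i, p i)) [0..<t]" for t
    by (induction t) (simp_all add: H_0 H_Suc b_def p_def)
  have follows: "follows \<sigma> b p"
    unfolding follows_def by (simp flip: H_eq) (simp add: b_def)
  have p_0: "p 0 \<in> pverts G \<and> (placement G k (b 0) \<longrightarrow> S (b 0) (p 0))"
  proof -
    have "\<exists>q. q \<in> pverts G \<and> (placement G k (b 0) \<longrightarrow> S (b 0) q)"
      using nonempty init by blast
    moreover have "p 0 = first (b 0)"
      by (simp add: p_def b_def \<tau>_def H_0)
    ultimately show ?thesis
      unfolding first_def by (metis (mono_tags, lifting) someI_ex)
  qed
  have p_Suc: "token_move G (p t) (p (Suc t)) \<and>
      ((\<exists>q. token_move G (p t) q \<and> S (b (Suc t)) q) \<longrightarrow> S (b (Suc t)) (p (Suc t)))" for t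
  proof -
    have "\<exists>p'. token_move G (p t) p' \<and> ((\<exists>q. token_move G (p t) q \<and> S (b (Suc t)) q) \<longrightarrow>
        S (b (Suc t)) p')"
      by (metis token_move_def)
    moreover have "p (Suc t) = reply (p t) (b (Suc t))"
      by (simp add: p_def b_def \<tau>_def H_Suc)
    ultimately show ?thesis
      unfolding reply_def by (metis (mono_tags, lifting) someI_ex)
  qed
  have "president_legal G p"
    using p_0 p_Suc by (simp add: president_legal_def)
  with \<sigma> follows have legal: "bodyguards_legal G k b" and win: "bodyguards_win_play G b p"
    by blast+
  have "S (b t) (p t)" for t
  proof (induction t)
    case 0
    then show ?case
      using p_0 legal by (simp add: bodyguards_legal_def)
  next
    case (Suc t)
    then show ?case
      using step p_Suc legal unfolding bodyguards_legal_def by blast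
  qed
  then have never: "\<not> surrounded G (b (Suc t)) (p t)" for t
    using step legal unfolding bodyguards_legal_def by blast
  obtain T where "\<forall>t\<ge>T. surrounded G (b (Suc t)) (p t)"
    using win unfolding bodyguards_win_play_def by blast
  then show False
    using never[of T] by simp
qed

section \<open>Integer coordinates on the cycle\<close>

text \<open>Vertices of the cycle are addressed by integers: \<open>cyc n\<close> is the universal covering.\<close>

definition cyc :: "nat \<Rightarrow> int \<Rightarrow> nat" where
  "cyc n i = nat (i mod int n)"

lemma cyc_eq_iff:
  assumes "n > 0"
  shows "cyc n i = cyc n j \<longleftrightarrow> int n dvd i - j"
  using assms by (simp add: cyc_def mod_eq_dvd_iff nat_eq_iff)

lemma cyc_of_nat: "u < n \<Longrightarrow> cyc n (int u) = u"
  by (simp add: cyc_def)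

lemma cyc_less: "n > 0 \<Longrightarrow> cyc n i < n"
  by (simp add: cyc_def nat_less_iff)

text \<open>Any window of n consecutive integers represents all vertices; below, the windows are
  placed relative to the president.\<close>

lemma cyc_lift:
  assumes "n > 0"
  obtains d where "l \<le> d" "d < l + int n" "cyc n x = cyc n d"
proof
  show "l \<le> l + (x - l) mod int n" "l + (x - l) mod int n < l + int n"
    using assms by simp_all
  have "int n dvd (x - l) - (x - l) mod int n"
    by (rule dvd_minus_mod)
  then show "cyc n x = cyc n (l + (x - l) mod int n)"
    using assms by (simp add: cyc_eq_iff algebra_simps)
qed

lemma cyc_Suc_mod: "n > 0 \<Longrightarrow> (cyc n i + 1) mod n = cyc n (i + 1)"
  by (simp add: cyc_def nat_eq_iff2 zmod_int mod_simps add.commute)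

lemma pverts_cycle_graph: "pverts (cycle_graph n) = {0..<n}"
  by (simp add: cycle_graph_def)

lemma open_nbhd_cyc:
  assumes "n > 0"
  shows "open_nbhd (cycle_graph n) (cyc n i) = {cyc n (i - 1), cyc n (i + 1)}"
proof -
  have "cyc n i = (w + 1) mod n \<longleftrightarrow> w = cyc n (i - 1)" if "w < n" for w
  proof -
    have "cyc n i = (w + 1) mod n \<longleftrightarrow> cyc n i = cyc n (int w + 1)"
      using cyc_Suc_mod[OF assms, of "int w"] cyc_of_nat[OF that] by simp
    also have "\<dots> \<longleftrightarrow> cyc n (int w) = cyc n (i - 1)"
      using assms dvd_minus_iff[of "int n" "i - (int w + 1)"] by (simp add: cyc_eq_iff algebra_simps)
    finally show ?thesis
      using cyc_of_nat[OF that] by simp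
  qed
  then show ?thesis
    using assms cyc_less[OF assms] cyc_Suc_mod[OF assms]
    by (auto simp: open_nbhd_def cycle_graph_def)
qed

lemma token_move_cyc_iff:
  assumes "n > 0"
  shows "token_move (cycle_graph n) (cyc n i) w \<longleftrightarrow> (\<exists>j. \<bar>j - i\<bar> \<le> 1 \<and> w = cyc n j)"
proof -
  have "\<bar>j - i\<bar> \<le> 1 \<longleftrightarrow> j = i \<or> j = i - 1 \<or> j = i + 1" for j
    by auto
  then show ?thesis
    using assms by (auto simp: token_move_def open_nbhd_cyc)
qed

lemma token_move_cyc:
  "n > 0 \<Longrightarrow> \<bar>j - i\<bar> \<le> 1 \<Longrightarrow> token_move (cycle_graph n) (cyc n i) (cyc n j)"
  using token_move_cyc_iff by blast

lemma surrounded_cyc_iff: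
  "n > 0 \<Longrightarrow> surrounded (cycle_graph n) bs (cyc n i) \<longleftrightarrow> cyc n (i - 1) \<in> set bs \<and> cyc n (i + 1) \<in> set bs"
  by (simp add: surrounded_def open_nbhd_cyc)

lemma cyc_pred_neq_succ: "n \<ge> 3 \<Longrightarrow> cyc n (i - 1) \<noteq> cyc n (i + 1)"
  using zdvd_imp_le[of "int n" 2] by (auto simp: cyc_eq_iff)

section \<open>Evasion by the president\<close>

lemma fewer_than_two_bodyguards_cannot_win:
  assumes "n \<ge> 3" "k < 2"
  shows "\<not> bodyguards_can_win (cycle_graph n) k"
proof (rule bodyguards_cannot_winI[where S = "\<lambda>bs p. p < n \<and> length bs < 2"])
  fix bs p bs'
  assume S: "p < n \<and> length bs < 2" and "bodyguards_move (cycle_graph n) bs bs'"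
  then have "length bs' < 2"
    by (auto simp: bodyguards_move_def dest: list_all2_lengthD)
  moreover have "\<not> surrounded (cycle_graph n) bs' p"
  proof
    assume "surrounded (cycle_graph n) bs' p"
    then have "{cyc n (int p - 1), cyc n (int p + 1)} \<subseteq> set bs'"
      using assms(1) S surrounded_cyc_iff[of n bs' "int p"] by (simp add: cyc_of_nat)
    then have "card {cyc n (int p - 1), cyc n (int p + 1)} \<le> card (set bs')"
      by (rule card_mono[rotated]) simp
    then show False
      using \<open>length bs' < 2\<close> card_length[of bs'] cyc_pred_neq_succ[OF assms(1), of "int p"] by simp
  qed
  ultimately show "\<not> surrounded (cycle_graph n) bs' p \<and>
      (\<exists>p'. token_move (cycle_graph n) p p' \<and> p' < n \<and> length bs' < 2)"
    using S by (auto simp: token_move_def intro: exI[of _ p])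
next
  fix bs
  assume "placement (cycle_graph n) k bs"
  then show "\<exists>p\<in>pverts (cycle_graph n). p < n \<and> length bs < 2"
    using assms by (intro bexI[of _ 0]) (simp_all add: pverts_cycle_graph placement_def)
qed (use assms(1) in \<open>simp add: pverts_cycle_graph\<close>)

text \<open>Replaces divisibility by three linear equations, so that positions near each other are
  handled by linear arithmetic.\<close>

lemma cyc_eq_small:
  assumes "n > 0" "\<bar>i - j\<bar> < 2 * int n"
  shows "cyc n i = cyc n j \<longleftrightarrow> i - j = 0 \<or> i - j = int n \<or> i - j = - int n"
proof
  assume "cyc n i = cyc n j"
  then obtain c where c: "i - j = int n * c"
    using assms(1) by (auto simp: cyc_eq_iff)
  have "\<bar>c\<bar> < 2"
    using assms by (simp add: c abs_mult)
  then have "c = 0 \<or> c = 1 \<or> c = -1"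
    by auto
  then show "i - j = 0 \<or> i - j = int n \<or> i - j = - int n"
    using c by auto
next
  assume "i - j = 0 \<or> i - j = int n \<or> i - j = - int n"
  then show "cyc n i = cyc n j"
    using assms(1) by (auto simp: cyc_eq_iff)
qed

text \<open>In coordinates relative to the president, two bodyguards can surround her in one turn
  iff one is in \<open>{0, 1, 2}\<close> and the other in \<open>{0, -1, -2}\<close> modulo \<open>n\<close>.  For \<open>n \<ge> 6\<close> the only
  position from which each of her three moves leads there is the one where she is already
  surrounded.\<close>

lemma escape_arith:
  fixes n x y :: int
  assumes "n \<ge> 6" "0 \<le> x" "x < n" "0 \<le> y" "y < n"
    and "\<not> (x = 1 \<and> y = n - 1)" "\<not> (y = 1 \<and> x = n - 1)"
  defines "R \<equiv> \<lambda>s z. 0 \<le> z - s \<and> z - s \<le> 2 \<or> z - s = n"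
    and "L \<equiv> \<lambda>s z. - 1 \<le> z - s \<and> z - s \<le> 0 \<or> n - 2 \<le> z - s"
  obtains s where "\<bar>s\<bar> \<le> 1" "\<not> (R s x \<and> L s y)" "\<not> (R s y \<and> L s x)"
proof -
  \<comment> \<open>For z in [0, n) and s in {-1, 0, 1}, the difference z - s lies in [-1, n];
    \<open>R\<close> and \<open>L\<close> spell out the two residue sets on that range.\<close>
  have "\<not> (R 1 x \<and> L 1 y) \<and> \<not> (R 1 y \<and> L 1 x) \<or> \<not> (R 0 x \<and> L 0 y) \<and> \<not> (R 0 y \<and> L 0 x) \<or>
      \<not> (R (-1) x \<and> L (-1) y) \<and> \<not> (R (-1) y \<and> L (-1) x)"
    using assms(1-7) unfolding R_def L_def by presburger
  then show ?thesis
    using that[of 1] that[of 0] that[of "-1"] by auto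
qed

lemma president_escapes_two_bodyguards:
  assumes "n > 5" and not_surrounded: "\<not> surrounded (cycle_graph n) [cyc n A, cyc n B] (cyc n P)"
  obtains p' where "token_move (cycle_graph n) (cyc n P) p'"
    and "\<And>bs'. bodyguards_move (cycle_graph n) [cyc n A, cyc n B] bs' \<Longrightarrow>
      \<not> surrounded (cycle_graph n) bs' p'"
proof -
  have n: "n > 0"
    using assms(1) by simp
  obtain a where a: "P \<le> a" "a < P + int n" "cyc n A = cyc n a"
    using cyc_lift[OF n] .
  obtain b where b: "P \<le> b" "b < P + int n" "cyc n B = cyc n b"
    using cyc_lift[OF n] .
  define x where "x = a - P"
  define y where "y = b - P"
  have "\<not> (x = 1 \<and> y = int n - 1)" "\<not> (y = 1 \<and> x = int n - 1)"
    using not_surrounded assms(1) by (auto simp: surrounded_cyc_iff[OF n] a b x_def y_def cyc_eq_small)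
  moreover have "0 \<le> x" "x < int n" "0 \<le> y" "y < int n"
    using a b by (auto simp: x_def y_def)
  moreover have "int n \<ge> 6"
    using assms(1) by simp
  ultimately obtain s where s: "\<bar>s\<bar> \<le> 1"
    "\<not> ((0 \<le> x - s \<and> x - s \<le> 2 \<or> x - s = int n) \<and>
      (- 1 \<le> y - s \<and> y - s \<le> 0 \<or> int n - 2 \<le> y - s))"
    "\<not> ((0 \<le> y - s \<and> y - s \<le> 2 \<or> y - s = int n) \<and>
      (- 1 \<le> x - s \<and> x - s \<le> 0 \<or> int n - 2 \<le> x - s))"
    using escape_arith by metis
  \<comment> \<open>A bodyguard at offset z from P who can get next to P + s on the right satisfies
    the condition \<open>R\<close> of \<open>escape_arith\<close>; \<open>reach'\<close> is the same
    for the left and \<open>L\<close>.\<close>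
  have reach: "(0 \<le> z - s \<and> z - s \<le> 2 \<or> z - s = int n)"
    if "cyc n (P + s + 1) = cyc n c'" "\<bar>c' - (P + z)\<bar> \<le> 1" "0 \<le> z" "z < int n" for c' z
    using that s(1) assms(1) by (subst (asm) cyc_eq_small) (auto simp: abs_if split: if_splits)
  have reach': "(- 1 \<le> z - s \<and> z - s \<le> 0 \<or> int n - 2 \<le> z - s)"
    if "cyc n (P + s - 1) = cyc n c'" "\<bar>c' - (P + z)\<bar> \<le> 1" "0 \<le> z" "z < int n" for c' z
    using that s(1) assms(1) by (subst (asm) cyc_eq_small) (auto simp: abs_if split: if_splits)
  show ?thesis
  proof
    show "token_move (cycle_graph n) (cyc n P) (cyc n (P + s))"
      using s(1) by (simp add: token_move_cyc[OF n])
    fix bs'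
    assume "bodyguards_move (cycle_graph n) [cyc n A, cyc n B] bs'"
    then obtain a' b' where bs': "bs' = [cyc n a', cyc n b']" "\<bar>a' - a\<bar> \<le> 1" "\<bar>b' - b\<bar> \<le> 1"
      unfolding bodyguards_move_def a b by (auto simp: list_all2_Cons1 token_move_cyc_iff[OF n])
    have ab: "\<bar>a' - (P + x)\<bar> \<le> 1" "\<bar>b' - (P + y)\<bar> \<le> 1"
      using bs' by (simp_all add: x_def y_def)
    show "\<not> surrounded (cycle_graph n) bs' (cyc n (P + s))"
    proof
      assume "surrounded (cycle_graph n) bs' (cyc n (P + s))"
      moreover have "cyc n (P + s - 1) \<noteq> cyc n (P + s + 1)"
        using cyc_pred_neq_succ assms(1) by simp
      ultimately have "cyc n (P + s + 1) = cyc n a' \<and> cyc n (P + s - 1) = cyc n b' \<or>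
          cyc n (P + s + 1) = cyc n b' \<and> cyc n (P + s - 1) = cyc n a'"
        unfolding surrounded_cyc_iff[OF n] bs' by auto
      then show False
        using s reach reach' ab \<open>0 \<le> x\<close> \<open>x < int n\<close> \<open>0 \<le> y\<close> \<open>y < int n\<close> by metis
    qed
  qed
qed

lemma two_bodyguards_cannot_win:
  assumes "n > 5"
  shows "\<not> bodyguards_can_win (cycle_graph n) 2"
proof -
  let ?G = "cycle_graph n"
  have n: "n > 0"
    using assms by simp
  \<comment> \<open>The president is safe when the coming bodyguard turn cannot surround her,
    however it is played.\<close>
  define S where "S bs p \<longleftrightarrow> (\<exists>A B P. bs = [cyc n A, cyc n B] \<and> p = cyc n P) \<and>
      (\<forall>bs'. bodyguards_move ?G bs bs' \<longrightarrow> \<not> surrounded ?G bs' p)" for bs p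
  have escape: "\<exists>p'. token_move ?G (cyc n P) p' \<and> S [cyc n A, cyc n B] p'"
    if "\<not> surrounded ?G [cyc n A, cyc n B] (cyc n P)" for A B P
    using president_escapes_two_bodyguards[OF assms that] token_move_cyc_iff[OF n]
    unfolding S_def by metis
  show ?thesis
  proof (rule bodyguards_cannot_winI[where S = S])
    fix bs
    assume "placement ?G 2 bs"
    then obtain u w where "bs = [u, w]" "u < n" "w < n"
      by (auto simp: placement_def pverts_cycle_graph length_Suc_conv numeral_2_eq_2)
    then have bs: "bs = [cyc n (int u), cyc n (int w)]"
      by (simp add: cyc_of_nat)
    \<comment> \<open>A fictitious start on the first bodyguard's vertex: only the second bodyguard
      could be on a neighbour. The actual start is the vertex to which she would escape from
      there.\<close>
    have "\<not> surrounded ?G bs (cyc n (int u))"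
    proof -
      have "cyc n (int u - 1) \<noteq> cyc n (int u)" "cyc n (int u + 1) \<noteq> cyc n (int u)"
        using assms by (simp_all add: cyc_eq_small)
      moreover have "cyc n (int u - 1) \<noteq> cyc n (int u + 1)"
        using assms by (simp add: cyc_pred_neq_succ)
      ultimately show ?thesis
        unfolding bs surrounded_cyc_iff[OF n] by auto
    qed
    then obtain p where "S bs p"
      using escape bs by blast
    then show "\<exists>p\<in>pverts ?G. S bs p"
      using cyc_less[OF n] by (auto simp: S_def pverts_cycle_graph)
  next
    fix bs p bs'
    assume S: "S bs p" and move: "bodyguards_move ?G bs bs'"
    then obtain A B P where "bs' = [cyc n A, cyc n B]" "p = cyc n P"
      by (auto simp: S_def bodyguards_move_def list_all2_Cons1 token_move_cyc_iff[OF n])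
    then show "\<not> surrounded ?G bs' p \<and> (\<exists>p'. token_move ?G p p' \<and> S bs' p')"
      using escape S move unfolding S_def by blast
  qed (use n in \<open>simp add: pverts_cycle_graph\<close>)
qed

section \<open>Strategies for the bodyguards\<close>

lemma flanking_persists:
  assumes "n > 0" "\<bar>P - Q\<bar> \<le> 1"
  shows "bodyguards_move (cycle_graph n) (cyc n (Q - 1) # cyc n (Q + 1) # bs)
    (cyc n (P - 1) # cyc n (P + 1) # bs)"
proof -
  have "list_all2 (token_move (cycle_graph n)) bs bs"
    by (rule list.rel_refl) (simp add: token_move_def)
  then show ?thesis
    using assms by (simp add: bodyguards_move_def token_move_cyc)
qed

lemma two_bodyguards_can_win:
  assumes "3 \<le> n" "n \<le> 5"
  shows "bodyguards_can_win (cycle_graph n) 2"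
proof -
  let ?G = "cycle_graph n"
  have n: "n > 0"
    using assms by simp
  \<comment> \<open>One turn suffices to flank the president. Every turn then ends with her
    surrounded, so the rank can stay constant.\<close>
  define I where "I r bs p \<longleftrightarrow> (\<exists>P bs'. p = cyc n P \<and> bodyguards_move ?G bs bs' \<and>
      mset bs' = mset [cyc n (P - 1), cyc n (P + 1)])" for r :: nat and bs p
  show ?thesis
  proof (rule bodyguards_can_winI[where I = I])
    show "placement ?G 2 [cyc n 0, cyc n 2]"
      using cyc_less[OF n] by (simp add: placement_def pverts_cycle_graph)
  next
    fix p
    assume "p \<in> pverts ?G"
    then have p: "p = cyc n (int p)" "p < n"
      by (simp_all add: pverts_cycle_graph cyc_of_nat)
    \<comment> \<open>The two bodyguards are at distance 2; for \<open>n \<le> 5\<close> that suffices to flank any vertex.\<close>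
    consider "p \<le> 2" | "p = 3" "n \<ge> 4" | "p = 4" "n = 5"
      using p(2) assms by linarith
    then have "I 0 [cyc n 0, cyc n 2] p"
    proof cases
      case 1
      then have "bodyguards_move ?G [cyc n 0, cyc n 2] [cyc n (int p - 1), cyc n (int p + 1)]"
        using flanking_persists[OF n, of "int p" 1 "[]"] by simp
      then show ?thesis
        unfolding I_def using p(1) by blast
    next
      case 2
      \<comment> \<open>4 - n is 0 or -1, so the bodyguard on 0 reaches 4 in one turn while the
        other stays on 2.\<close>
      have "cyc n 4 = cyc n (4 - int n)"
        by (simp add: cyc_eq_iff[OF n])
      then have "bodyguards_move ?G [cyc n 0, cyc n 2] [cyc n 4, cyc n 2]"
        using 2 assms(2) by (simp add: bodyguards_move_def token_move_cyc[OF n])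
      moreover have "mset [cyc n 4, cyc n 2] = mset [cyc n (3 - 1), cyc n (3 + 1)]"
        by simp
      moreover have "p = cyc n 3"
        using 2 p(1) by simp
      ultimately show ?thesis
        unfolding I_def by blast
    next
      case 3
      have "cyc n 3 = cyc n (-1 - 1)" "p = cyc n (-1)"
        using 3 by (simp_all add: cyc_def)
      moreover have "bodyguards_move ?G [cyc n 0, cyc n 2] [cyc n 0, cyc n 3]"
        by (simp add: bodyguards_move_def token_move_cyc[OF n])
      moreover have "mset [cyc n 0, cyc n 3] = mset [cyc n (-1 - 1), cyc n (-1 + 1)]"
        using calculation(1) by simp
      ultimately show ?thesis
        unfolding I_def by blast
    qed
    then show "\<exists>r. I r [cyc n 0, cyc n 2] p" ..
  next
    fix r bs p
    assume "I r bs p"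
    then obtain P bs' where p: "p = cyc n P" and move: "bodyguards_move ?G bs bs'"
      and bs': "mset bs' = mset [cyc n (P - 1), cyc n (P + 1)]"
      unfolding I_def by blast
    have "set bs' = {cyc n (P - 1), cyc n (P + 1)}"
      using mset_eq_setD[OF bs'] by simp
    then have "surrounded ?G bs' p"
      by (simp add: p surrounded_cyc_iff[OF n])
    moreover have "I r [cyc n (P - 1), cyc n (P + 1)] p'" if "token_move ?G p p'" for p'
      using that flanking_persists[OF n, of _ P "[]"] unfolding I_def p token_move_cyc_iff[OF n] by blast
    ultimately show "\<exists>bs'. bodyguards_move ?G bs bs' \<and>
        (\<forall>p'. token_move ?G p p' \<longrightarrow> (\<exists>r'\<le>r. \<exists>cs. mset cs = mset bs' \<and> I r' cs p' \<and>
          (surrounded ?G bs' p \<or> r' < r)))"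
      using move bs' by (metis order_refl)
  qed
qed

text \<open>Two bodyguards close in on the president from both sides until one of them, the escort, stands
  on her vertex.  From then on the escort follows her, while the other two close in from both
  sides; whichever arrives first flanks her together with the escort, and flanking two bodyguards
  can mirror all her moves.\<close>

lemma three_bodyguards_can_win:
  assumes "n \<ge> 3"
  shows "bodyguards_can_win (cycle_graph n) 3"
proof -
  let ?G = "cycle_graph n"
  have n: "n > 0"
    using assms by simp
  \<comment> \<open>The president's move shifts length between \<open>d\<close> and \<open>e\<close>
    but keeps their sum. The offset 2n + 3 places every rank here above 2n + 2, the largest rank at
    which the escorted phase is entered.\<close>
  define closing where "closing r bs P \<longleftrightarrow> (\<exists>d e Z. bs = [cyc n (P + d), cyc n (P - e), cyc n Z] \<and>
      0 \<le> d \<and> 0 \<le> e \<and> r = nat (d + e) + 2 * n + 3)" for r bs P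
  \<comment> \<open>\<open>Q\<close> is the vertex the president has just left or stayed on: the
    escort is still there, and the distances of the other two are measured from it.\<close>
  define escorted where "escorted r bs P \<longleftrightarrow> (\<exists>Q d e. \<bar>P - Q\<bar> \<le> 1 \<and>
      bs = [cyc n Q, cyc n (Q + d), cyc n (Q - e)] \<and> 2 \<le> d \<and> 2 \<le> e \<and> r = nat (d + e))" for r bs P
  define flanked where "flanked r bs P \<longleftrightarrow> (\<exists>Q Z. \<bar>P - Q\<bar> \<le> 1 \<and>
      bs = [cyc n (Q - 1), cyc n (Q + 1), cyc n Z] \<and> r = 0)" for r :: nat and bs P
  define I where "I r bs p \<longleftrightarrow> (\<exists>P. p = cyc n P \<and>
      (closing r bs P \<or> escorted r bs P \<or> flanked r bs P))" for r bs p
  define Step where "Step r bs p \<longleftrightarrow> (\<exists>bs'. bodyguards_move ?G bs bs' \<and>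
      (\<forall>p'. token_move ?G p p' \<longrightarrow> (\<exists>r'\<le>r. \<exists>cs. mset cs = mset bs' \<and> I r' cs p' \<and>
        (surrounded ?G bs' p \<or> r' < r))))" for r bs p
  have to_flanked: "Step r bs (cyc n P)" if "bodyguards_move ?G bs bs'"
    "mset bs' = mset [cyc n (P - 1), cyc n (P + 1), cyc n Z]" for r bs bs' P Z
  proof -
    have "set bs' = {cyc n (P - 1), cyc n (P + 1), cyc n Z}"
      using mset_eq_setD[OF that(2)] by simp
    then have "surrounded ?G bs' (cyc n P)"
      by (simp add: surrounded_cyc_iff[OF n])
    moreover have "I 0 [cyc n (P - 1), cyc n (P + 1), cyc n Z] p'"
      if "token_move ?G (cyc n P) p'" for p'
      using that unfolding I_def flanked_def token_move_cyc_iff[OF n] by blast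
    ultimately show ?thesis
      unfolding Step_def using that by (metis le0)
  qed
  have to_escorted: "Step r bs (cyc n P)" if "bodyguards_move ?G bs bs'"
    "mset bs' = mset [cyc n P, cyc n (P + d), cyc n (P - e)]" "2 \<le> d" "2 \<le> e" "nat (d + e) < r"
    for r bs bs' P d e
  proof -
    have "I (nat (d + e)) [cyc n P, cyc n (P + d), cyc n (P - e)] p'"
      if "token_move ?G (cyc n P) p'" for p'
      using that \<open>2 \<le> d\<close> \<open>2 \<le> e\<close> unfolding I_def escorted_def token_move_cyc_iff[OF n] by blast
    then show ?thesis
      unfolding Step_def using that(1,2,5) by (metis less_imp_le)
  qed
  have to_first_escorted: "Step r bs (cyc n P)" if "bodyguards_move ?G bs bs'"
    "mset bs' = mset [cyc n P, cyc n X, cyc n Y]" "2 * n + 2 < r" for r bs bs' P X Y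
  proof -
    \<comment> \<open>Wherever the other two stand, one is regarded as coming from the right and one
      from the left, each at distance between 2 and n + 1 along the covering line.\<close>
    obtain x where x: "P + 2 \<le> x" "x < P + 2 + int n" "cyc n X = cyc n x"
      using cyc_lift[OF n] .
    obtain y where y: "P - int n - 1 \<le> y" "y < P - int n - 1 + int n" "cyc n Y = cyc n y"
      using cyc_lift[OF n] .
    show ?thesis
      by (rule to_escorted[OF that(1), of P "x - P" "P - y"]) (use that x y in auto)
  qed
  show ?thesis
  proof (rule bodyguards_can_winI[where I = I])
    show "placement ?G 3 [cyc n 0, cyc n 0, cyc n 0]"
      using cyc_less[OF n] by (simp add: placement_def pverts_cycle_graph)
  next
    fix p
    assume "p \<in> pverts ?G"
    then have p: "p = cyc n (int p)" "p < n"
      by (simp_all add: pverts_cycle_graph cyc_of_nat)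
    \<comment> \<open>Bodyguards sharing vertex 0 already enclose the president: on the covering
      line they are lifted to n and to 0.\<close>
    have "cyc n 0 = cyc n (int p + (int n - int p))" "cyc n 0 = cyc n (int p - int p)"
      by (simp_all add: cyc_eq_iff[OF n])
    then have "closing (nat (int n - int p + int p) + 2 * n + 3) [cyc n 0, cyc n 0, cyc n 0] (int p)"
      unfolding closing_def using p(2) by (metis diff_ge_0_iff_ge less_imp_le of_nat_0_le_iff of_nat_mono)
    then show "\<exists>r. I r [cyc n 0, cyc n 0, cyc n 0] p"
      unfolding I_def using p(1) by blast
  next
    fix r bs p
    assume "I r bs p"
    then obtain P where p: "p = cyc n P"
      and "closing r bs P \<or> escorted r bs P \<or> flanked r bs P"
      unfolding I_def by blast
    then consider "closing r bs P" | "escorted r bs P" | "flanked r bs P"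
      by blast
    then have "Step r bs (cyc n P)"
    proof cases
      case 1
      then obtain d e Z where bs: "bs = [cyc n (P + d), cyc n (P - e), cyc n Z]"
        and de: "0 \<le> d" "0 \<le> e" and r: "r = nat (d + e) + 2 * n + 3"
        unfolding closing_def by blast
      consider "d \<le> 1" | "e \<le> 1" | "2 \<le> d" "2 \<le> e"
        by linarith
      then show ?thesis
      proof cases
        case 1
        show ?thesis
          by (rule to_first_escorted[of _ "[cyc n P, cyc n (P - e), cyc n Z]" P "P - e" Z])
            (use 1 de in \<open>simp_all add: bs r bodyguards_move_def token_move_cyc[OF n]\<close>)
      next
        case 2
        show ?thesis
          by (rule to_first_escorted[of _ "[cyc n (P + d), cyc n P, cyc n Z]" P "P + d" Z])
            (use 2 de in \<open>simp_all add: bs r bodyguards_move_def token_move_cyc[OF n]\<close>)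
      next
        case 3
        let ?bs = "[cyc n (P + (d - 1)), cyc n (P - (e - 1)), cyc n Z]"
        have "bodyguards_move ?G bs ?bs"
          by (simp add: bs bodyguards_move_def token_move_cyc[OF n])
        moreover have "I (nat (d + e - 2) + 2 * n + 3) ?bs p'"
          if move: "token_move ?G (cyc n P) p'" for p'
        proof -
          obtain P' where P': "\<bar>P' - P\<bar> \<le> 1" "p' = cyc n P'"
            using move unfolding token_move_cyc_iff[OF n] by blast
          have "closing (nat (d + e - 2) + 2 * n + 3) ?bs P'"
            unfolding closing_def
            by (rule exI[of _ "P + (d - 1) - P'"], rule exI[of _ "P' - (P - (e - 1))"], rule exI[of _ Z])
              (use 3 P'(1) in \<open>auto simp: algebra_simps\<close>)
          then show ?thesis
            unfolding I_def using P'(2) by blast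
        qed
        moreover have "nat (d + e - 2) + 2 * n + 3 < r"
          using 3 r by simp
        ultimately show ?thesis
          unfolding Step_def by (metis less_imp_le)
      qed
    next
      case 2
      then obtain Q d e where bs: "bs = [cyc n Q, cyc n (Q + d), cyc n (Q - e)]"
        and PQ: "\<bar>P - Q\<bar> \<le> 1" and de: "2 \<le> d" "2 \<le> e" and r: "r = nat (d + e)"
        unfolding escorted_def by blast
      \<comment> \<open>A pursuer within two steps of her can move next to her. The comparison of
        \<open>P\<close> with \<open>Q\<close> ensures that the escort can take her other side; if
        she stepped away from a pursuer, that one is still at least three steps off.\<close>
      consider (right) "P \<ge> Q" "Q + d - P \<le> 2" | (left) "P \<le> Q" "P - (Q - e) \<le> 2"
        | (continue) "Q + d - P \<ge> 3" "P - (Q - e) \<ge> 3"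
        using PQ de by linarith
      then show ?thesis
      proof cases
        case right
        show ?thesis
          by (rule to_flanked[of _ "[cyc n (P - 1), cyc n (P + 1), cyc n (Q - e)]" P "Q - e"])
            (use right PQ de in \<open>simp_all add: bs bodyguards_move_def token_move_cyc[OF n]\<close>)
      next
        case left
        show ?thesis
          by (rule to_flanked[of _ "[cyc n (P + 1), cyc n (Q + d), cyc n (P - 1)]" P "Q + d"])
            (use left PQ de in \<open>simp_all add: bs bodyguards_move_def token_move_cyc[OF n]\<close>)
      next
        case continue
        show ?thesis
          by (rule to_escorted[of _ "[cyc n P, cyc n (Q + d - 1), cyc n (Q - e + 1)]" P
                "Q + d - 1 - P" "P - (Q - e + 1)"])
            (use continue PQ de in \<open>simp_all add: bs r bodyguards_move_def token_move_cyc[OF n] algebra_simps\<close>)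
      qed
    next
      case 3
      then obtain Q Z where bs: "bs = [cyc n (Q - 1), cyc n (Q + 1), cyc n Z]" and PQ: "\<bar>P - Q\<bar> \<le> 1"
        unfolding flanked_def by blast
      show ?thesis
        unfolding bs by (rule to_flanked[OF flanking_persists[OF n PQ] refl])
    qed
    then show "\<exists>bs'. bodyguards_move ?G bs bs' \<and>
        (\<forall>p'. token_move ?G p p' \<longrightarrow> (\<exists>r'\<le>r. \<exists>cs. mset cs = mset bs' \<and> I r' cs p' \<and>
          (surrounded ?G bs' p \<or> r' < r)))"
      unfolding Step_def p .
  qed
qed

theorem theorem3p1:
  fixes n :: nat
  assumes "n \<ge> 3"
  shows "(n \<le> 5 \<longrightarrow> bodyguard_number (cycle_graph n) = 2) \<and>
         (n > 5 \<longrightarrow> bodyguard_number (cycle_graph n) = 3)"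
proof (intro conjI impI)
  have ge_2: "2 \<le> k" if "bodyguards_can_win (cycle_graph n) k" for k
    using fewer_than_two_bodyguards_cannot_win[OF assms] that not_le by blast
  {
    assume "n \<le> 5"
    with ge_2 show "bodyguard_number (cycle_graph n) = 2"
      unfolding bodyguard_number_def
      by (intro Least_equality two_bodyguards_can_win assms)
  next
    assume "n > 5"
    have "3 \<le> k" if "bodyguards_can_win (cycle_graph n) k" for k
      using ge_2[OF that] two_bodyguards_cannot_win[OF \<open>n > 5\<close>] that by (cases "k = 2") auto
    then show "bodyguard_number (cycle_graph n) = 3"
      unfolding bodyguard_number_def
      by (intro Least_equality three_bodyguards_can_win assms)
  }
qed

end
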